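(* Let $m\geq 0$ and $n\geq m+3$ be integers, and let $$N_{n,m}(x)=\sum_{k=0}^n \left(\binom{n}{k}\binom{m}{k}-\binom{n}{k+1}\binom{m}{k-1}\right) x^k .$$ Let $r_{n,m}^{+}$ denote the unique positive zero of $N_{n,m}(x)$. Then $$\frac{2(n+1)}{(m+1-n)\big((m+2)^2-(n+1)^2-1\big)}<r_{n,m}^{+}\leq \frac{2}{(m-n)(m+1-n)},$$ where the equality in the right-hand inequality holds only for $m=0$.
   Context: Binomial coefficients $\binom{a}{b}$ are taken to be $0$ when $b<0$ or $b>a$. It is known (Chen, Yang and Zhang) that for $m\geq 0$ and $n\geq m+2$ the polynomial $N_{n,m}(x)$ has only real zeros and exactly one positive zero; $r_{n,m}^{+}$ denotes this positive zero. *)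

theory Defs
  imports Complex_Main "HOL-Computational_Algebra.Polynomial"
begin

text \<open>
  The case distinction implements the convention that the binomial coefficient of \<open>m\<close> over
  \<open>k - 1\<close> vanishes for \<open>k = 0\<close> (on \<^typ>\<open>nat\<close>, \<open>k - 1\<close> would truncate to \<open>0\<close>). The vanishing
  for a lower index exceeding the upper one is built into \<^const>\<open>binomial\<close>.
\<close>

definition N_poly :: "nat \<Rightarrow> nat \<Rightarrow> real poly" where
  "N_poly n m =
     (\<Sum>k\<le>n. monom (real (n choose k) * real (m choose k)
       - (if k = 0 then 0 else real (n choose (k + 1)) * real (m choose (k - 1)))) k)"

text \<open>
  Meaningful for \<open>n \<ge> m + 2\<close>, where \<open>N_poly n m\<close> has exactly one positive zero.
\<close>

definition r_pos :: "nat \<Rightarrow> nat \<Rightarrow> real" where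
  "r_pos n m = (THE r. r > 0 \<and> poly (N_poly n m) r = 0)"

end

theory Submission
  imports Defs "HOL-Analysis.Elementary_Metric_Spaces"
begin

text \<open>
  Put \<open>M = m + 1\<close>, \<open>d = n - m\<close> and let \<open>F\<close> be the polynomial with coefficients
  \<open>(n + 1 choose k + 1) (M choose k)\<close>. Then \<open>M (n + 1) N = M F - d x F'\<close>, so the positive zero of \<open>N\<close>
  is the point where \<open>u = x F'/F\<close> takes the value \<open>M / d\<close>. The hypergeometric equation of \<open>F\<close>
  becomes a Riccati equation for \<open>u\<close>, and as long as \<open>0 < u \<le> M / d\<close> its solution cannot cross
  the curves \<open>x = 2 u / (d (M - u))\<close> (for \<open>M > 1\<close>) and
  \<open>x = 2 u (u + 1) / ((M - u) (M + n + 1 - 2 u))\<close>, between which it starts at \<open>x = 0\<close>.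
  At \<open>u = M / d\<close> these curves pass through the two claimed bounds.
\<close>

section \<open>A first-crossing argument\<close>

text \<open>Just left of the least zero \<open>a\<close>, the condition \<open>f' a > 0\<close>
  makes \<open>f\<close> negative, so the intermediate value theorem yields a smaller zero.\<close>

lemma no_zero_crossing_pos:
  fixes f f' :: "real \<Rightarrow> real"
  assumes "0 \<le> b" and f0: "f 0 > 0"
    and der: "\<And>x. 0 \<le> x \<Longrightarrow> x \<le> b \<Longrightarrow> (f has_real_derivative f' x) (at x)"
    and up: "\<And>x. 0 < x \<Longrightarrow> x \<le> b \<Longrightarrow> f x = 0 \<Longrightarrow> f' x > 0"
  shows "f b > 0"
proof (rule ccontr)
  assume "\<not> f b > 0"
  have cont: "continuous_on {0..b} f"
    by (rule DERIV_continuous_on) (use der has_field_derivative_at_within in fastforce)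
  define Z where "Z = {x \<in> {0..b}. f x = 0}"
  have "\<exists>x\<ge>0. x \<le> b \<and> f x = 0"
    by (rule IVT2') (use \<open>\<not> f b > 0\<close> f0 \<open>0 \<le> b\<close> cont in auto)
  then have "Z \<noteq> {}" by (auto simp: Z_def)
  moreover have "closed Z"
    unfolding Z_def by (intro continuous_closed_preimage_constant cont) simp
  moreover have bdd: "bdd_below Z" by (rule bdd_belowI[of _ 0]) (auto simp: Z_def)
  ultimately have "Inf Z \<in> Z" by (intro closed_contains_Inf)
  define a where "a = Inf Z"
  have a: "0 \<le> a" "a \<le> b" "f a = 0" using \<open>Inf Z \<in> Z\<close> by (auto simp: Z_def a_def)
  with f0 have "0 < a" by (cases "a = 0") auto
  obtain e where e: "e > 0" "\<And>h. 0 < h \<Longrightarrow> h < e \<Longrightarrow> f (a - h) < f a"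
    using DERIV_pos_inc_left[OF der[OF a(1,2)] up[OF \<open>0 < a\<close> a(2,3)]] by auto
  define h where "h = min e a / 2"
  have h: "0 < h" "h < e" "h < a" using e \<open>0 < a\<close> by (auto simp: h_def)
  have neg: "f (a - h) < 0" using e(2)[OF h(1,2)] a(3) by simp
  have "\<exists>x\<ge>0. x \<le> a - h \<and> f x = 0"
    by (rule IVT2') (use neg f0 h a in \<open>auto intro: continuous_on_subset[OF cont]\<close>)
  then obtain x where x: "0 \<le> x" "x \<le> a - h" "f x = 0" by blast
  then have "x \<in> Z" using a h by (auto simp: Z_def)
  then have "a \<le> x" unfolding a_def by (rule cInf_lower[OF _ bdd])
  with x h show False by simp
qed

section \<open>Crossing directions at the two barrier curves\<close>

text \<open>
  In both lemmas below, \<open>w\<close> plays the role of the derivative of \<open>v = F'/F\<close>, and \<open>x v\<close> of the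
  logarithmic derivative \<open>u = x F'/F\<close>; the assumption \<open>ric\<close> is the Riccati equation
  \<open>x (1 - x) u' = x (M - u) (n - u) - u (1 + u)\<close>.
\<close>

lemma riccati_upper_crossing:
  fixes M n x v w :: real
  assumes M: "1 < M" and n: "M + 2 \<le> n" and x: "0 < x" and v: "0 < v"
    and u: "(n + 1 - M) * (x * v) \<le> M"
    and ric: "x * (1 - x) * (v + x * w) = x * (M - x * v) * (n - x * v) - x * v * (1 + x * v)"
    and zero: "2 * v - (n + 1 - M) * (M - x * v) = 0"
  shows "2 * w + (n + 1 - M) * (v + x * w) > 0"
proof -
  define d where "d = n + 1 - M"
  define u where "u = x * v"
  define V where "V = x * (v + x * w)"
  have d: "d \<ge> 3" using n by (simp add: d_def)
  have u0: "0 < u" using x v by (simp add: u_def)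
  have du: "d * u \<le> M" using u by (simp add: u_def d_def)
  have "3 * u \<le> d * u" using d u0 by (intro mult_right_mono) auto
  then have uM: "u < M" using du u0 by linarith
  have xdu: "x * d * (M - u) = 2 * u"
    using zero unfolding u_def d_def by algebra
  have "V * (1 - x) = x * (M - u) * (n - u) - u * (1 + u)"
    using ric by (simp add: V_def u_def algebra_simps)
  \<comment> \<open>Multiplying by \<open>d * (M - u)\<close> and inserting \<open>xdu\<close>
    eliminates \<open>x\<close>; here \<open>V\<close> is \<open>x\<close> times the derivative of
    \<open>u\<close>.\<close>
  then have "V * (M * d - (d + 2) * u) = u * (M - u) * (2 * n - d - (d + 2) * u)"
    using xdu by algebra
  then have V: "V * (M * d - (d + 2) * u) = u * (M - u) * (2 * M + d - 2 - (d + 2) * u)"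
    by (simp add: d_def algebra_simps)
  have "(d + 2) * u \<le> M + 2 * u" using du by (simp add: algebra_simps)
  also have "\<dots> < 2 * M" using \<open>3 * u \<le> d * u\<close> du M by linarith
  finally have B: "(d + 2) * u < 2 * M" .
  have "2 * M \<le> M * d" using d M by simp
  then have S: "0 < M * d - (d + 2) * u" using B by linarith
  \<comment> \<open>This product is exactly the difference of the two sides below, and
    \<open>M > 1\<close> makes it strict.\<close>
  have "0 < (M - 1) * (2 * M - (d + 2) * u)" using B M by simp
  then have "M * d - (d + 2) * u < M * (2 * M + d - 2 - (d + 2) * u)"
    by (simp add: algebra_simps)
  then have "(u * (M - u)) * (M * d - (d + 2) * u)
      < (u * (M - u)) * (M * (2 * M + d - 2 - (d + 2) * u))"
    using u0 uM by (intro mult_strict_left_mono) auto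
  also have "\<dots> = (V * M) * (M * d - (d + 2) * u)" using V by algebra
  finally have VM: "u * (M - u) < V * M" using S by (simp add: mult_less_cancel_right)
  have "(2 * u) * (M - u) < (V * (2 + x * d)) * (M - u)"
  proof -
    have "(V * (2 + x * d)) * (M - u) = 2 * (V * M)" using xdu by algebra
    then show ?thesis using VM by linarith
  qed
  then have "2 * u < V * (2 + x * d)" using uM by (simp add: mult_less_cancel_right)
  moreover have "x\<^sup>2 * (2 * w + d * (v + x * w)) = V * (2 + x * d) - 2 * u"
    unfolding V_def u_def by algebra
  ultimately have "0 < x\<^sup>2 * (2 * w + d * (v + x * w))" by simp
  then show ?thesis using x by (simp add: d_def zero_less_mult_iff)
qed

lemma riccati_lower_crossing:
  fixes M n x v w :: real
  assumes M: "1 \<le> M" and n: "M + 2 \<le> n" and x: "0 < x" and v: "0 < v"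
    and u: "(n + 1 - M) * (x * v) \<le> M"
    and ric: "x * (1 - x) * (v + x * w) = x * (M - x * v) * (n - x * v) - x * v * (1 + x * v)"
    and zero: "(M - x * v) * (M + n + 1 - 2 * (x * v)) - 2 * v * (x * v + 1) = 0"
  shows "- ((v + x * w) * (M + n + 1 - 2 * (x * v))) - 2 * ((v + x * w) * (M - x * v))
    - 2 * w * (x * v + 1) - 2 * v * (v + x * w) > 0"
proof -
  define d where "d = n + 1 - M"
  define u where "u = x * v"
  define V where "V = x * (v + x * w)"
  define Y where "Y = M + n + 1 - 2 * u"
  define S where "S = (M - u) * Y - 2 * u * (u + 1)"
  have d: "d \<ge> 3" using n by (simp add: d_def)
  have u0: "0 < u" using x v by (simp add: u_def)
  have du: "d * u \<le> M" using u by (simp add: u_def d_def)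
  have "3 * u \<le> d * u" using d u0 by (intro mult_right_mono) auto
  then have uM: "u < M" using du u0 by linarith
  have Y: "2 * (M - u) < Y" using n by (simp add: Y_def)
  have xY: "x * (M - u) * Y = 2 * u * (u + 1)"
    using zero unfolding u_def Y_def by algebra
  have "V * (1 - x) = x * (M - u) * (n - u) - u * (1 + u)"
    using ric by (simp add: V_def u_def algebra_simps)
  \<comment> \<open>Multiplying by \<open>(M - u) * Y\<close> and inserting \<open>xY\<close>
    eliminates \<open>x\<close>; the factor \<open>d - 2\<close> is
    \<open>2 * (n - u) - Y\<close>.\<close>
  then have VS: "V * S = u * (u + 1) * (M - u) * (d - 2)"
    using xY unfolding S_def Y_def d_def by algebra
  have Seq: "S = M * (2 * M + d) - u * (4 * M + d + 2)"
    unfolding S_def Y_def d_def by algebra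
  \<comment> \<open>The right-hand side is the exact gap in \<open>S1\<close>; this is where the
    bound \<open>du\<close> is decisive.\<close>
  have "0 \<le> 4 * (M + 1) * (M - d * u)" using M d du by simp
  then have S1: "(d - 2) * (2 * (M * (2 * u + 1) + u)) \<le> 2 * S"
    unfolding Seq by (simp add: algebra_simps)
  have S0: "0 < S"
  proof -
    have "0 < (d - 2) * (2 * (M * (2 * u + 1) + u))"
      using d M u0 by (intro mult_pos_pos add_pos_pos) auto
    then show ?thesis using S1 by linarith
  qed
  \<comment> \<open>By \<open>xY\<close>, the term quadratic in \<open>M - u\<close> is thus below
    \<open>2 * u * (u + 1)\<close>, which removes \<open>x\<close> from the estimate.\<close>
  have "(x * (M - u)) * (2 * (M - u)) < (x * (M - u)) * Y"
    using x uM Y by (intro mult_strict_left_mono) auto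
  then have "(M - u) * (x * Y + 2 * x * (M - u) + 4 * u + 2) < 2 * (M * (2 * u + 1) + u)"
    using xY by (simp add: algebra_simps)
  then have "(d - 2) * ((M - u) * (x * Y + 2 * x * (M - u) + 4 * u + 2))
      < (d - 2) * (2 * (M * (2 * u + 1) + u))"
    using d by (intro mult_strict_left_mono) auto
  then have "(d - 2) * ((M - u) * (x * Y + 2 * x * (M - u) + 4 * u + 2)) < 2 * S"
    using S1 by linarith
  then have "(u * (u + 1)) * ((d - 2) * ((M - u) * (x * Y + 2 * x * (M - u) + 4 * u + 2)))
      < (u * (u + 1)) * (2 * S)"
    using u0 by (intro mult_strict_left_mono) auto
  moreover have "(u * (u + 1)) * ((d - 2) * ((M - u) * (x * Y + 2 * x * (M - u) + 4 * u + 2)))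
      = (V * (x * Y + 2 * x * (M - u) + 4 * u + 2)) * S"
    using VS by algebra
  ultimately have "(V * (x * Y + 2 * x * (M - u) + 4 * u + 2)) * S < (2 * u * (u + 1)) * S"
    by (simp add: algebra_simps)
  then have "V * (x * Y + 2 * x * (M - u) + 4 * u + 2) < 2 * u * (u + 1)"
    using S0 by (simp add: mult_less_cancel_right)
  moreover have "x\<^sup>2 * (- ((v + x * w) * Y) - 2 * ((v + x * w) * (M - u))
      - 2 * w * (u + 1) - 2 * v * (v + x * w))
      = 2 * u * (u + 1) - V * (x * Y + 2 * x * (M - u) + 4 * u + 2)"
    unfolding V_def u_def by algebra
  ultimately have "0 < x\<^sup>2 * (- ((v + x * w) * Y) - 2 * ((v + x * w) * (M - u))
      - 2 * w * (u + 1) - 2 * v * (v + x * w))"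
    by simp
  then show ?thesis using x by (simp add: Y_def u_def zero_less_mult_iff)
qed

section \<open>The hypergeometric polynomial and its differential equation\<close>

text \<open>Up to the factor \<open>n + 1\<close>, this is the hypergeometric polynomial \<open>2F1(-M, -n; 2; x)\<close>.\<close>

definition hyp_poly :: "nat \<Rightarrow> nat \<Rightarrow> real poly" where
  "hyp_poly M n = (\<Sum>k\<le>M. monom (real (Suc n choose Suc k) * real (M choose k)) k)"

lemma coeff_hyp_poly: "coeff (hyp_poly M n) k = real (Suc n choose Suc k) * real (M choose k)"
  by (simp add: hyp_poly_def coeff_sum)

lemma coeff_N_poly:
  "coeff (N_poly n m) k = real (n choose k) * real (m choose k)
     - (if k = 0 then 0 else real (n choose (k + 1)) * real (m choose (k - 1)))"
  by (auto simp: N_poly_def coeff_sum binomial_eq_0)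

lemma real_binomial_Suc_right:
  "real (n choose Suc k) * (real k + 1) = real (n choose k) * (real n - real k)"
proof (cases "k \<le> n")
  case True
  have "real (Suc k * (n choose Suc k)) = real ((n - k) * (n choose k))"
    by (simp only: binomial_absorb_comp binomial_absorption)
  then show ?thesis using True by (simp add: of_nat_diff algebra_simps)
qed (simp add: binomial_eq_0)

lemma coeff_hyp_poly_Suc:
  "coeff (hyp_poly M n) (Suc k) * ((real k + 1) * (real k + 2))
    = coeff (hyp_poly M n) k * ((real M - real k) * (real n - real k))"
  using real_binomial_Suc_right[of "Suc n" "Suc k"] real_binomial_Suc_right[of M k]
  by (simp only: coeff_hyp_poly) (simp del: binomial_Suc_Suc, algebra)

text \<open>Comparing coefficients reduces the equation to the recursion
  \<open>coeff_hyp_poly_Suc\<close>.\<close>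

lemma hyp_poly_ode:
  "x * (1 - x) * poly (pderiv (pderiv (hyp_poly M n))) x
     + (2 + (real M + real n - 1) * x) * poly (pderiv (hyp_poly M n)) x
     - real M * real n * poly (hyp_poly M n) x = 0"
proof -
  let ?F = "hyp_poly M n"
  let ?P = "pCons 0 (pderiv (pderiv ?F)) - pCons 0 (pCons 0 (pderiv (pderiv ?F)))
     + smult 2 (pderiv ?F) + smult (real M + real n - 1) (pCons 0 (pderiv ?F))
     - smult (real M * real n) ?F"
  have "coeff ?P k = 0" for k
  proof -
    have "coeff ?P k = coeff ?F (Suc k) * ((real k + 1) * (real k + 2))
       - coeff ?F k * ((real M - real k) * (real n - real k))"
      by (cases k; cases "k - 1") (simp_all add: coeff_pderiv algebra_simps)
    then show ?thesis using coeff_hyp_poly_Suc by simp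
  qed
  then have "?P = 0" by (simp add: poly_eq_iff)
  then have "poly ?P x = 0" by simp
  then show ?thesis by (simp add: algebra_simps)
qed

section \<open>The link with \<open>N_poly\<close>\<close>

definition crit_poly :: "nat \<Rightarrow> nat \<Rightarrow> real poly" where
  "crit_poly M n = smult (real M) (hyp_poly M n)
     - smult (real n + 1 - real M) (pCons 0 (pderiv (hyp_poly M n)))"

lemma coeff_crit_poly:
  "coeff (crit_poly M n) k = coeff (hyp_poly M n) k * (real M - real k * (real n + 1 - real M))"
  by (cases k) (simp_all add: crit_poly_def coeff_pderiv algebra_simps)

lemma poly_crit_poly:
  "poly (crit_poly M n) x = real M * poly (hyp_poly M n) x
     - (real n + 1 - real M) * (x * poly (pderiv (hyp_poly M n)) x)"
  by (simp add: crit_poly_def)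

text \<open>By Pascal's rule and absorption, each product of binomials on the left is a rational
  multiple of \<open>(e + f) * (a + b)\<close>.\<close>

lemma N_poly_eq_crit_poly:
  "smult ((real m + 1) * (real n + 1)) (N_poly n m) = crit_poly (Suc m) n"
proof (rule poly_eqI)
  fix k
  show "coeff (smult ((real m + 1) * (real n + 1)) (N_poly n m)) k = coeff (crit_poly (Suc m) n) k"
  proof (cases k)
    case 0
    then show ?thesis by (simp add: coeff_crit_poly coeff_hyp_poly coeff_N_poly algebra_simps)
  next
    case (Suc j)
    define a b e f where "a = real (m choose j)" and "b = real (m choose k)"
      and "e = real (n choose k)" and "f = real (n choose Suc k)"
    have b: "b * (real j + 1) = a * (real m - real j)"
      using real_binomial_Suc_right[of m j] by (simp add: a_def b_def Suc)
    have f: "f * (real j + 2) = e * (real n - real j - 1)"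
      using real_binomial_Suc_right[of n k] by (simp add: e_def f_def Suc algebra_simps)
    have "(real m + 1) * b = (a + b) * (real m - real j)"
      "(real m + 1) * a = (a + b) * (real j + 1)" "(real n + 1) * e = (e + f) * (real j + 2)"
      using b f by algebra+
    then have "(real j + 2) * ((real m + 1) * (real n + 1) * (e * b - f * a))
        = (real j + 2) * ((e + f) * (a + b) * (real m + 1 - (real j + 1) * (real n - real m)))"
      using f by algebra
    then have "(real m + 1) * (real n + 1) * (e * b - f * a)
        = (e + f) * (a + b) * (real m + 1 - (real j + 1) * (real n - real m))"
      by (simp add: mult_cancel_left)
    then show ?thesis
      by (simp add: coeff_crit_poly coeff_hyp_poly coeff_N_poly Suc a_def b_def e_def f_def add_ac)
  qed
qed

lemma poly_pos_of_coeff_nonneg: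
  fixes p :: "real poly"
  assumes "\<And>k. coeff p k \<ge> 0" and "coeff p 0 > 0" and "x \<ge> 0"
  shows "poly p x > 0"
  unfolding poly_altdef
  by (rule sum_pos2[where i = 0]) (use assms in auto)

lemma hyp_poly_pos: "x \<ge> 0 \<Longrightarrow> poly (hyp_poly M n) x > 0"
  by (rule poly_pos_of_coeff_nonneg) (auto simp: coeff_hyp_poly simp del: binomial_Suc_Suc)

lemma pderiv_hyp_poly_pos:
  assumes "M \<ge> 1" "n \<ge> 1" "x \<ge> 0"
  shows "poly (pderiv (hyp_poly M n)) x > 0"
proof (rule poly_pos_of_coeff_nonneg)
  have "(Suc n choose Suc 1) > 0" by (rule zero_less_binomial) (use assms in simp)
  then show "coeff (pderiv (hyp_poly M n)) 0 > 0"
    using assms by (simp add: coeff_pderiv coeff_hyp_poly del: binomial_Suc_Suc)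
qed (use assms in \<open>auto simp: coeff_pderiv coeff_hyp_poly simp del: binomial_Suc_Suc\<close>)

section \<open>The logarithmic derivative and its Riccati equation\<close>

text \<open>The factor \<open>x\<close> of \<open>u\<close> is left out because \<open>u\<close>
  vanishes at \<open>0\<close>: the barrier functions written with \<open>v\<close> are nonzero
  there and can start the crossing argument.\<close>

definition hyp_ld :: "nat \<Rightarrow> nat \<Rightarrow> real \<Rightarrow> real" where
  "hyp_ld M n x = poly (pderiv (hyp_poly M n)) x / poly (hyp_poly M n) x"

definition hyp_ld' :: "nat \<Rightarrow> nat \<Rightarrow> real \<Rightarrow> real" where
  "hyp_ld' M n x = poly (pderiv (pderiv (hyp_poly M n))) x / poly (hyp_poly M n) x - (hyp_ld M n x)\<^sup>2"

lemma hyp_ld_pos: "M \<ge> 1 \<Longrightarrow> n \<ge> 1 \<Longrightarrow> x \<ge> 0 \<Longrightarrow> hyp_ld M n x > 0"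
  by (simp add: hyp_ld_def hyp_poly_pos pderiv_hyp_poly_pos)

lemma hyp_ld_0: "hyp_ld M n 0 = real M * real n / 2"
proof -
  have "2 * poly (pderiv (hyp_poly M n)) 0 = real M * real n * poly (hyp_poly M n) 0"
    using hyp_poly_ode[of 0 M n] by simp
  then show ?thesis
    using hyp_poly_pos[of 0 M n] by (simp add: hyp_ld_def field_simps)
qed

lemma hyp_ld_has_derivative:
  assumes "x \<ge> 0"
  shows "(hyp_ld M n has_real_derivative hyp_ld' M n x) (at x)"
  unfolding hyp_ld_def[abs_def] hyp_ld'_def
  by (rule derivative_eq_intros poly_DERIV refl)+
    (use hyp_poly_pos[OF assms, of M n] in \<open>simp_all add: field_simps power2_eq_square\<close>)

text \<open>Divide \<open>hyp_poly_ode\<close> by \<open>F\<close>, replace \<open>F''/F\<close> by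
  \<open>w + v\<^sup>2\<close>, and multiply by \<open>x\<close>.\<close>

lemma hyp_ld_riccati:
  fixes M n :: nat and x :: real
  assumes "x \<ge> 0"
  defines "v \<equiv> hyp_ld M n x" and "w \<equiv> hyp_ld' M n x"
  shows "x * (1 - x) * (v + x * w)
    = x * (real M - x * v) * (real n - x * v) - x * v * (1 + x * v)"
proof -
  define F where "F = poly (hyp_poly M n) x"
  define h where "h = poly (pderiv (pderiv (hyp_poly M n))) x / F"
  have F: "F > 0" unfolding F_def by (rule hyp_poly_pos) fact
  have "poly (pderiv (hyp_poly M n)) x = v * F" "poly (pderiv (pderiv (hyp_poly M n))) x = h * F"
    using F by (auto simp: v_def hyp_ld_def h_def F_def)
  then have "F * (x * (1 - x) * h + (2 + (real M + real n - 1) * x) * v - real M * real n) = 0"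
    using hyp_poly_ode[of x M n] by (simp add: F_def algebra_simps)
  then have "x * (1 - x) * h + (2 + (real M + real n - 1) * x) * v - real M * real n = 0"
    using F by simp
  moreover have "w = h - v\<^sup>2" by (simp add: w_def v_def hyp_ld'_def h_def F_def)
  ultimately show ?thesis by algebra
qed

text \<open>As \<open>F > 0\<close>, the sign of \<open>crit_poly\<close> decides whether
  \<open>u\<close> is below or above \<open>M / d\<close>.\<close>

lemma poly_crit_poly_hyp_ld:
  assumes "x \<ge> 0"
  shows "poly (crit_poly M n) x
    = poly (hyp_poly M n) x * (real M - (real n + 1 - real M) * (x * hyp_ld M n x))"
  using hyp_poly_pos[OF assms, of M n] by (simp add: poly_crit_poly hyp_ld_def field_simps)

text \<open>
  The signs of the coefficients change once, at \<open>k = M / (n + 1 - M)\<close>; hence the polynomial divided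
  by \<open>x powr (M / (n + 1 - M))\<close> is strictly decreasing.
\<close>

lemma crit_poly_neg_beyond:
  assumes "M \<ge> 1" "M \<le> n" "0 < x" "x < y" "poly (crit_poly M n) x \<le> 0"
  shows "poly (crit_poly M n) y < 0"
proof -
  define d where "d = real n + 1 - real M"
  define s where "s = real M / d"
  define t where "t = y / x"
  have d: "d > 0" using assms by (simp add: d_def)
  have s: "s > 0" using assms d by (simp add: s_def)
  have t: "t > 1" using assms by (simp add: t_def)
  let ?a = "\<lambda>k. coeff (crit_poly M n) k"
  have a: "?a k = (coeff (hyp_poly M n) k * d) * (s - real k)" for k
    using d by (simp add: coeff_crit_poly s_def d_def field_simps)
  have c: "coeff (hyp_poly M n) k * d \<ge> 0" for k using d by (simp add: coeff_hyp_poly)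
  have yk: "y ^ k = x ^ k * t powr real k" for k
    using assms t by (simp add: t_def powr_realpow power_divide)
  \<comment> \<open>For \<open>k > s\<close> the power comparison reverses, but so does the sign of
    \<open>s - k\<close>.\<close>
  have pw: "(s - real k) * t powr real k \<le> (s - real k) * t powr s" for k
    using t by (cases "real k \<le> s") (auto intro: mult_left_mono mult_left_mono_neg)
  have le: "?a k * y ^ k \<le> ?a k * x ^ k * t powr s" for k
  proof -
    have "coeff (hyp_poly M n) k * d * x ^ k \<ge> 0" using c[of k] assms by simp
    from mult_left_mono[OF pw[of k] this] show ?thesis by (simp add: a yk mult_ac)
  qed
  have "0 < ?a 0" using assms by (simp add: coeff_crit_poly coeff_hyp_poly)
  moreover have "1 < t powr s" using t s by simp
  ultimately have lt: "?a 0 * y ^ 0 < ?a 0 * x ^ 0 * t powr s" by simp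
  have "poly (crit_poly M n) y < (\<Sum>k\<le>degree (crit_poly M n). ?a k * x ^ k * t powr s)"
    unfolding poly_altdef by (rule sum_strict_mono_ex1) (use le lt in \<open>auto intro!: bexI[of _ 0]\<close>)
  also have "\<dots> = poly (crit_poly M n) x * t powr s"
    by (simp add: poly_altdef sum_distrib_right)
  also have "\<dots> \<le> 0" using assms by (simp add: mult_nonpos_nonneg)
  finally show ?thesis .
qed

section \<open>Bounds for the positive zero\<close>

text \<open>If \<open>crit_poly\<close> were nonnegative on all of \<open>[0, b]\<close>, then
  \<open>d * u \<le> M\<close> there and the barrier would persist up to \<open>b\<close>, where it
  says \<open>d * u > M\<close>.\<close>

lemma crit_poly_upper:
  assumes "M \<ge> 2" "n \<ge> M + 2"
  defines "b \<equiv> 2 / ((real n + 1 - real M) * (real n - real M))"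
  obtains r where "0 < r" "r < b" "poly (crit_poly M n) r = 0"
proof -
  define d where "d = real n + 1 - real M"
  let ?v = "hyp_ld M n" and ?w = "hyp_ld' M n"
  have d: "d \<ge> 3" using assms by (simp add: d_def)
  have b_eq: "b = 2 / (d * (d - 1))" by (simp add: b_def d_def)
  have b: "b > 0" using d by (simp add: b_eq)
  have "\<exists>x. 0 \<le> x \<and> x \<le> b \<and> poly (crit_poly M n) x < 0"
  proof (rule ccontr)
    assume "\<not> ?thesis"
    then have nonneg: "poly (crit_poly M n) x \<ge> 0" if "0 \<le> x" "x \<le> b" for x
      using that by (meson not_le)
    have u: "d * (x * ?v x) \<le> real M" if "0 \<le> x" "x \<le> b" for x
      using nonneg[OF that] hyp_poly_pos[OF that(1), of M n]
      by (simp add: poly_crit_poly_hyp_ld that d_def zero_le_mult_iff)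
    have "2 * ?v b - d * (real M - b * ?v b) > 0"
    proof (rule no_zero_crossing_pos[where f = "\<lambda>x. 2 * ?v x - d * (real M - x * ?v x)"
          and f' = "\<lambda>x. 2 * ?w x + d * (?v x + x * ?w x)"])
      \<comment> \<open>At \<open>0\<close> the barrier function equals
        \<open>M * n - d * M\<close>, and \<open>d < n\<close> because
        \<open>M \<ge> 2\<close>.\<close>
      have "real M * d < real M * real n"
        using assms by (intro mult_strict_left_mono) (auto simp: d_def)
      then show "2 * ?v 0 - d * (real M - 0 * ?v 0) > 0" by (simp add: hyp_ld_0 mult_ac)
    next
      fix x assume "0 \<le> x" "x \<le> b"
      then show "((\<lambda>x. 2 * ?v x - d * (real M - x * ?v x)) has_real_derivative
          2 * ?w x + d * (?v x + x * ?w x)) (at x)"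
        by (auto intro!: derivative_eq_intros hyp_ld_has_derivative simp: algebra_simps)
    next
      fix x assume x: "0 < x" "x \<le> b" "2 * ?v x - d * (real M - x * ?v x) = 0"
      show "2 * ?w x + d * (?v x + x * ?w x) > 0"
        unfolding d_def
        by (rule riccati_upper_crossing)
          (use assms x u[of x] hyp_ld_pos[of M n x] hyp_ld_riccati[of x M n] in \<open>simp_all add: d_def\<close>)
    qed (use b in simp)
    moreover have "2 * ?v b = (d * (d - 1)) * (b * ?v b)" using d by (simp add: b_eq)
    ultimately have "d * (d * (b * ?v b) - real M) > 0" by (simp add: algebra_simps)
    then show False using u[of b] b d by (simp add: zero_less_mult_iff)
  qed
  then obtain x where x: "0 \<le> x" "x \<le> b" "poly (crit_poly M n) x < 0" by blast
  have P0: "poly (crit_poly M n) 0 > 0"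
    using assms by (simp add: poly_crit_poly hyp_poly_pos)
  obtain r where r: "0 \<le> r" "r \<le> x" "poly (crit_poly M n) r = 0"
    using IVT2'[of "poly (crit_poly M n)" x 0 0] x P0 continuous_on_poly[OF continuous_on_id]
    by force
  show ?thesis
  proof
    show "0 < r" using r P0 by (cases "r = 0") auto
    show "r < b" using r x by (cases "r = x") auto
    show "poly (crit_poly M n) r = 0" by fact
  qed
qed

text \<open>By \<open>crit_poly_neg_beyond\<close>, \<open>crit_poly\<close> is nonnegative before
  its zero \<open>r\<close>, so the barrier holds up to \<open>r\<close>; inserting
  \<open>d * u = M\<close> there gives the bound.\<close>

lemma crit_poly_lower:
  assumes "M \<ge> 1" "n \<ge> M + 2" "0 < r" "poly (crit_poly M n) r = 0"
  shows "2 * (real n + 1) / ((real M - real n) * ((real M + 1)\<^sup>2 - (real n + 1)\<^sup>2 - 1)) < r"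
proof -
  define d where "d = real n + 1 - real M"
  let ?v = "hyp_ld M n" and ?w = "hyp_ld' M n"
  let ?f = "\<lambda>x. (real M - x * ?v x) * (real M + real n + 1 - 2 * (x * ?v x))
    - 2 * ?v x * (x * ?v x + 1)"
  let ?f' = "\<lambda>x. - ((?v x + x * ?w x) * (real M + real n + 1 - 2 * (x * ?v x)))
    - 2 * ((?v x + x * ?w x) * (real M - x * ?v x))
    - 2 * ?w x * (x * ?v x + 1) - 2 * ?v x * (?v x + x * ?w x)"
  have d: "d \<ge> 3" using assms by (simp add: d_def)
  have u: "d * (x * ?v x) \<le> real M" if "0 < x" "x \<le> r" for x
  proof -
    have "poly (crit_poly M n) x \<ge> 0"
      using crit_poly_neg_beyond[of M n x r] that assms by (cases "x = r") force+
    then show ?thesis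
      using hyp_poly_pos[of x M n] that
      by (simp add: poly_crit_poly_hyp_ld d_def zero_le_mult_iff)
  qed
  have fr: "?f r > 0"
  proof (rule no_zero_crossing_pos[where f = ?f and f' = ?f'])
    \<comment> \<open>This is the value of the barrier function at \<open>0\<close>.\<close>
    have "0 < real M * (real M + 1)" using assms by simp
    then show "?f 0 > 0" by (simp add: hyp_ld_0 algebra_simps)
  next
    fix x assume "0 \<le> x" "x \<le> r"
    then show "(?f has_real_derivative ?f' x) (at x)"
      by (auto intro!: derivative_eq_intros hyp_ld_has_derivative simp: algebra_simps)
  next
    fix x assume x: "0 < x" "x \<le> r" "?f x = 0"
    show "?f' x > 0"
      by (rule riccati_lower_crossing)
        (use assms x u[of x] hyp_ld_pos[of M n x] hyp_ld_riccati[of x M n] in \<open>simp_all add: d_def\<close>)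
  qed (use assms in simp)
  have ur: "d * (r * ?v r) = real M"
    using assms hyp_poly_pos[of r M n] by (simp add: poly_crit_poly_hyp_ld d_def)
  define q where "q = (d - 1) * (2 * real M * (d - 1) + d\<^sup>2)"
  \<comment> \<open>The factor \<open>r * d\<^sup>2\<close> lets \<open>v\<close> enter only through
    \<open>d * (r * v)\<close>, which \<open>ur\<close> evaluates.\<close>
  have "r * d\<^sup>2 * ?f r = r * (d * real M - d * (r * ?v r))
      * (d * (real M + real n + 1) - 2 * (d * (r * ?v r))) - 2 * (d * (r * ?v r)) * (d * (r * ?v r) + d)"
    by (simp add: algebra_simps power2_eq_square)
  also have "\<dots> = real M * (r * q - 2 * (real n + 1))"
    unfolding ur by (simp add: q_def d_def algebra_simps power2_eq_square)
  finally have "r * d\<^sup>2 * ?f r = real M * (r * q - 2 * (real n + 1))" .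
  moreover have "0 < r * d\<^sup>2 * ?f r" using fr assms d by (intro mult_pos_pos) auto
  ultimately have "0 < real M * (r * q - 2 * (real n + 1))" by simp
  then have "2 * (real n + 1) < r * q" using assms by (simp add: zero_less_mult_iff)
  moreover have "q > 0" using d by (auto simp: q_def intro!: mult_pos_pos add_nonneg_pos)
  moreover have "(real M - real n) * ((real M + 1)\<^sup>2 - (real n + 1)\<^sup>2 - 1) = q"
    unfolding q_def d_def by algebra
  ultimately show ?thesis by (simp add: divide_less_eq)
qed

text \<open>For \<open>M = 1\<close>, excluded from the strict upper bound, the polynomial is linear
  and its zero attains that bound.\<close>

lemma poly_crit_poly_1: "poly (crit_poly 1 n) x = (real n + 1) * (1 - real n * (real n - 1) / 2 * x)"
proof -
  have "real (Suc n choose 2) = (real n + 1) * real n / 2"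
    using real_binomial_Suc_right[of "Suc n" 1] by (simp add: numeral_2_eq_2 del: binomial_Suc_Suc)
  then have "hyp_poly 1 n = [:real n + 1, (real n + 1) * real n / 2:]"
    by (simp add: hyp_poly_def monom_altdef numeral_2_eq_2 del: binomial_Suc_Suc)
  then show ?thesis by (simp add: poly_crit_poly pderiv_pCons field_simps)
qed

text \<open>Of two positive zeros the larger would contradict \<open>crit_poly_neg_beyond\<close>,
  so the description is well defined.\<close>

lemma r_pos_eqI:
  assumes "n \<ge> m + 1" "0 < r" "poly (crit_poly (Suc m) n) r = 0"
  shows "r_pos n m = r"
proof -
  have root: "poly (N_poly n m) x = 0 \<longleftrightarrow> poly (crit_poly (Suc m) n) x = 0" for x
    by (simp flip: N_poly_eq_crit_poly)
  show ?thesis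
    unfolding r_pos_def root
  proof (rule the_equality)
    fix x assume "0 < x \<and> poly (crit_poly (Suc m) n) x = 0"
    then show "x = r"
      using assms crit_poly_neg_beyond[of "Suc m" n x r] crit_poly_neg_beyond[of "Suc m" n r x]
      by (cases x r rule: linorder_cases) auto
  qed (use assms in simp)
qed

theorem theorem3p1:
  fixes m n :: nat
  assumes "n \<ge> m + 3"
  shows "2 * (real n + 1) / ((real m + 1 - real n) * ((real m + 2)\<^sup>2 - (real n + 1)\<^sup>2 - 1)) < r_pos n m
    \<and> r_pos n m \<le> 2 / ((real m - real n) * (real m + 1 - real n))
    \<and> (r_pos n m = 2 / ((real m - real n) * (real m + 1 - real n)) \<longleftrightarrow> m = 0)"
proof -
  define b where "b = 2 / ((real m - real n) * (real m + 1 - real n))"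
  \<comment> \<open>The conditional keeps strictness for \<open>m > 0\<close>, so one zero serves
    both the bound and the equality case.\<close>
  have "\<exists>r. 0 < r \<and> poly (crit_poly (Suc m) n) r = 0 \<and> (if m = 0 then r = b else r < b)"
  proof (cases "m = 0")
    case True
    have "b = 2 / (real n * (real n - 1))"
      using True by (simp add: b_def algebra_simps)
    then show ?thesis
      using True assms poly_crit_poly_1[of n b] by (intro exI[of _ b]) simp
  next
    case False
    have "(real n + 1 - real (Suc m)) * (real n - real (Suc m))
        = (real m - real n) * (real m + 1 - real n)"
      by (simp add: algebra_simps)
    then show ?thesis
      using crit_poly_upper[of "Suc m" n] False assms unfolding b_def by force
  qed
  then obtain r where r: "0 < r" "poly (crit_poly (Suc m) n) r = 0"
    "if m = 0 then r = b else r < b" by blast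
  have "2 * (real n + 1) / ((real m + 1 - real n) * ((real m + 2)\<^sup>2 - (real n + 1)\<^sup>2 - 1)) < r"
    using crit_poly_lower[of "Suc m" n r] r assms by (simp add: add_ac)
  moreover have "r_pos n m = r" by (rule r_pos_eqI) (use r assms in auto)
  ultimately show ?thesis
    using r(3) unfolding b_def[symmetric] by (auto split: if_splits)
qed

end
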